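(* For $n\ge1$ the total area $u(n)=\sum_{w\in\mathcal{M}_n}\mathrm{area}(w)$ over all Motzkin polyominoes of length $n$ is given by $$u(n)=\frac{1}{2}\left(3^n-T_n\right)=\frac{1}{2}\left(3^n-\sum_{k=0}^n\binom{n}{k}\binom{n-k}{k}\right),$$ where $T_n$ is the $n$-th central trinomial coefficient, and $u(n)\sim 3^n/2$ as $n\to\infty$.
   Context: A Motzkin word of length $n\ge 1$ is a word $w=w_1\cdots w_n$ over the positive integers such that $w_1=1$, and $1\le w_k\le w_{k-1}+1$ and $w_{k-1}\ne w_k$ for $k=2,\dots,n$; $\mathcal{M}_n$ is the set of Motzkin words of length $n$. To $w$ one associates the Motzkin polyomino $P(w)$ of length $n$ with $n$ columns, all bottom-justified, whose $i$-th column consists of $w_i$ unit cells. $\mathrm{area}(w)$ is the number of cells of $P(w)$, i.e. $w_1+\cdots+w_n$. The central trinomial coefficient $T_n$ is the coefficient of $x^n$ in $(1+x+x^2)^n$. *)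

theory Defs
  imports
    Complex_Main
    "HOL-Computational_Algebra.Polynomial"
    "HOL-Library.Landau_Symbols"
begin

text \<open>Lists are indexed from 0, so the letter $w_k$ is \<open>w ! (k - 1)\<close>.
  The length \<open>n\<close> is meant to be positive; for \<open>n = 0\<close> the term \<open>w ! 0\<close> is unspecified.\<close>

definition motzkin_words :: "nat \<Rightarrow> nat list set" where
  "motzkin_words n = {w. length w = n \<and> (\<forall>a\<in>set w. 1 \<le> a) \<and> w ! 0 = 1 \<and>
     (\<forall>k\<in>{1..<n}. w ! k \<le> w ! (k - 1) + 1 \<and> w ! (k - 1) \<noteq> w ! k)}"

text \<open>The unit cell with upper right corner \<open>(i, j)\<close> is represented by that corner.\<close>

definition polyomino :: "nat list \<Rightarrow> (nat \<times> nat) set" where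
  "polyomino w = {(i, j). i \<in> {1..length w} \<and> j \<in> {1..w ! (i - 1)}}"

definition area :: "nat list \<Rightarrow> nat" where
  "area w = card (polyomino w)"

lemma area_eq_sum_list: "area w = sum_list w"
proof -
  have "polyomino w = Sigma {1..length w} (\<lambda>i. {1..w ! (i - 1)})"
    by (auto simp: polyomino_def)
  then have "area w = (\<Sum>i\<in>{1..length w}. w ! (i - 1))"
    by (simp add: area_def card_SigmaI)
  also have "\<dots> = (\<Sum>i<length w. w ! i)"
    by (rule sum.reindex_bij_witness[of _ Suc "\<lambda>i. i - 1"]) auto
  finally show ?thesis
    by (simp add: sum_list_sum_nth atLeast0LessThan)
qed

lemma motzkin_words_nth_le:
  assumes "w \<in> motzkin_words n" "k < n"
  shows "w ! k \<le> Suc k"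
  using assms(2)
proof (induction k)
  case 0
  then show ?case using assms(1) by (simp add: motzkin_words_def)
next
  case (Suc k)
  then have "w ! Suc k \<le> w ! (Suc k - 1) + 1"
    using assms(1) unfolding motzkin_words_def by fastforce
  with Suc show ?case by simp
qed

lemma finite_motzkin_words: "finite (motzkin_words n)"
proof (rule finite_subset)
  show "motzkin_words n \<subseteq> {w. set w \<subseteq> {..n} \<and> length w = n}"
  proof
    fix w assume w: "w \<in> motzkin_words n"
    then have len: "length w = n" by (simp add: motzkin_words_def)
    have "a \<le> n" if "a \<in> set w" for a
      using that len motzkin_words_nth_le[OF w] by (metis Suc_leI in_set_conv_nth le_trans)
    with len show "w \<in> {w. set w \<subseteq> {..n} \<and> length w = n}" by auto
  qed
  show "finite {w. set w \<subseteq> {..n} \<and> length w = n}"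
    by (rule finite_lists_length_eq) simp
qed

definition total_area :: "nat \<Rightarrow> nat" where
  "total_area n = (\<Sum>w\<in>motzkin_words n. area w)"

definition central_trinomial :: "nat \<Rightarrow> nat" where
  "central_trinomial n = coeff ([:1, 1, 1:] ^ n) n"

end

theory Submission
  imports Defs
begin

text \<open>
  A letter \<open>a\<close> of a Motzkin word may be followed by any letter below \<open>a\<close> or by \<open>a + 1\<close>, so counting
  words letter by letter iterates the operator \<open>(T \<phi>)(a) = (\<Sum>b=1..<a. \<phi> b) + \<phi> (a + 1)\<close>. In the basis of
  the polynomials \<open>\<phi>\<^sub>j(a) = (a - 1 choose j)\<close> this operator becomes
  \<open>T \<phi>\<^sub>j = \<phi>\<^sub>j\<^sub>-\<^sub>1 + \<phi>\<^sub>j + \<phi>\<^sub>j\<^sub>+\<^sub>1\<close> with \<open>\<phi>\<^sub>-\<^sub>1 = 0\<close>, that is, one step of the walk on the nonnegative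
  integers with steps -1, 0 and 1 (\<open>transition_binom_transform\<close>). Multiplication by \<open>a\<close>, which records
  the area of one column, is bidiagonal (\<open>mult_binom_transform\<close>).

  The area generated by all words that start with a given letter therefore satisfies, in this basis,
  a linear recurrence for walks on a half line, and the reflection principle reduces everything to
  unrestricted walks. With \<open>t j\<close> the number of walks of length \<open>n\<close> from 0 to \<open>j\<close>, the
  coefficients of the total area of the words of length \<open>n\<close> are
  \<open>(j + 1) * (j / 2 * (t j + t (j + 1)) + (\<Sum>i>j. t i))\<close> (\<open>area_coeff_Suc\<close>).
  Motzkin words start with the letter 1, where only \<open>\<phi>\<^sub>0\<close> does not vanish: the total area is the number
  of walks that end at a positive position. By symmetry this is half of the walks that do not end at 0,
  namely \<open>(3 ^ n - t 0) / 2\<close>, and \<open>t 0\<close> is the central trinomial coefficient.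

  For the asymptotics it remains to see that \<open>t 0\<close> is negligible against \<open>3 ^ n\<close>. The proportion of
  walks that end at 0 is decreasing, and the recurrence transfers its limit \<open>L\<close> to every other
  end point; as the proportions sum to at most 1, \<open>L\<close> must be 0 (\<open>trin_0_div_tendsto_0\<close>).
\<close>

section \<open>Walks with steps -1, 0, 1\<close>

text \<open>The number of walks with \<open>n\<close> steps from 0 to \<open>j\<close>; up to a shift of the index these are the
  coefficients of \<open>(1 + x + x\<^sup>2) ^ n\<close>.\<close>

primrec trin :: "nat \<Rightarrow> int \<Rightarrow> real" where
  "trin 0 j = of_bool (j = 0)"
| "trin (Suc n) j = trin n (j - 1) + trin n j + trin n (j + 1)"

text \<open>The number of walks with \<open>n\<close> steps from 0 that end strictly above \<open>j\<close>. The tails of the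
  distribution satisfy the recurrence of the distribution itself; starting the recurrence from the indicator of
  the negative integers avoids infinite sums.\<close>

primrec trin_above :: "nat \<Rightarrow> int \<Rightarrow> real" where
  "trin_above 0 j = of_bool (j < 0)"
| "trin_above (Suc n) j = trin_above n (j - 1) + trin_above n j + trin_above n (j + 1)"

lemma trin_minus: "trin n (- j) = trin n j"
proof (induction n arbitrary: j)
  case (Suc n)
  have "- j - 1 = - (j + 1)" "- j + 1 = - (j - 1)" by simp_all
  then have "trin n (- j - 1) = trin n (j + 1)" "trin n (- j + 1) = trin n (j - 1)"
    by (simp_all only: Suc)
  then show ?case using Suc[of j] by simp
qed simp

lemma trin_eq_0: "j < - int n \<Longrightarrow> trin n j = 0"
  by (induction n arbitrary: j) auto

lemma trin_nonneg: "0 \<le> trin n j"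
  by (induction n arbitrary: j) auto

lemma trin_above_nonneg: "0 \<le> trin_above n j"
  by (induction n arbitrary: j) auto

lemma trin_above_pred: "trin_above n (j - 1) = trin_above n j + trin n j"
proof (induction n arbitrary: j)
  case (Suc n)
  show ?case using Suc[of "j - 1"] Suc[of j] Suc[of "j + 1"] by simp
qed auto

text \<open>Reversing the steps turns walks that end above \<open>- j - 1\<close> into walks that end at most at \<open>j\<close>.\<close>

lemma trin_above_reflect: "trin_above n j + trin_above n (- j - 1) = 3 ^ n"
proof (induction n arbitrary: j)
  case (Suc n)
  show ?case using Suc[of "j - 1"] Suc[of j] Suc[of "j + 1"] by (simp add: algebra_simps)
qed auto

lemma trin_above_0: "trin_above n 0 = (3 ^ n - trin n 0) / 2"
  using trin_above_reflect[of n 0] trin_above_pred[of n 0] by simp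

lemma coeff_trinomial_power: "real (coeff ([:1, 1, 1:] ^ n) k) = trin n (int k - int n)"
proof (induction n arbitrary: k)
  case 0
  show ?case by (auto simp: coeff_pCons split: nat.split)
next
  case (Suc n)
  let ?q = "[:1, 1, 1:] ^ n :: nat poly"
  have q: "[:1, 1, 1:] ^ Suc n = ?q + pCons 0 ?q + pCons 0 (pCons 0 ?q)"
    by (simp add: add.assoc del: One_nat_def)
  have z: "trin n (- 1 - int n) = 0" "trin n (- 2 - int n) = 0"
    by (simp_all add: trin_eq_0)
  consider "k = 0" | "k = Suc 0" | i where "k = Suc (Suc i)"
    by (metis not0_implies_Suc)
  then have "real (coeff (?q + pCons 0 ?q + pCons 0 (pCons 0 ?q)) k) =
      trin n (int k - 2 - int n) + trin n (int k - 1 - int n) + trin n (int k - int n)"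
    by cases (simp_all add: z Suc.IH del: One_nat_def)
  moreover have "trin (Suc n) (int k - int (Suc n)) =
      trin n (int k - 2 - int n) + trin n (int k - 1 - int n) + trin n (int k - int n)"
    unfolding trin.simps
    by (intro arg_cong2[where f = "(+)"] arg_cong[where f = "trin n"]) simp_all
  ultimately show ?case
    by (simp only: q)
qed

lemma central_trinomial_eq_trin: "real (central_trinomial n) = trin n 0"
  by (simp add: central_trinomial_def coeff_trinomial_power del: One_nat_def)

lemma coeff_one_plus_X_power: "coeff ([:1, 1:] ^ n :: nat poly) k = n choose k"
proof (induction n arbitrary: k)
  case 0
  show ?case by (cases k) auto
next
  case (Suc n)
  show ?case by (cases k) (simp_all add: Suc.IH del: One_nat_def)
qed

text \<open>Expand \<open>(x\<^sup>2 + (1 + x)) ^ n\<close>: if \<open>x\<^sup>2\<close> is chosen \<open>k\<close> times, the remaining factor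
  \<open>(1 + x) ^ (n - k)\<close> has to contribute \<open>x ^ (n - 2 * k)\<close>.\<close>

lemma central_trinomial_eq_sum:
  "central_trinomial n = (\<Sum>k=0..n. (n choose k) * ((n - k) choose k))"
proof -
  have "[:1, 1, 1:] = monom 1 2 + ([:1, 1:] :: nat poly)"
    by (simp add: monom_altdef power2_eq_square)
  then have "[:1, 1, 1:] ^ n = (\<Sum>k\<le>n. of_nat (n choose k) * monom 1 2 ^ k * [:1, 1:] ^ (n - k) :: nat poly)"
    by (simp add: binomial_ring)
  also have "\<dots> = (\<Sum>k\<le>n. smult (n choose k) (monom 1 (2 * k) * [:1, 1:] ^ (n - k)))"
    by (simp add: monom_power of_nat_poly)
  finally have "central_trinomial n =
      (\<Sum>k\<le>n. (n choose k) * coeff (monom 1 (2 * k) * [:1, 1:] ^ (n - k)) n)"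
    by (simp add: central_trinomial_def coeff_sum)
  also have "\<dots> = (\<Sum>k\<le>n. (n choose k) * ((n - k) choose k))"
  proof (intro sum.cong refl arg_cong2[where f = "(*)"])
    fix k
    show "coeff (monom 1 (2 * k) * [:1, 1:] ^ (n - k)) n = (n - k) choose k"
    proof (cases "2 * k \<le> n")
      case True
      then have "(n - k) choose k = (n - k) choose (n - 2 * k)"
        by (subst binomial_symmetric) auto
      with True show ?thesis by (simp add: coeff_monom_mult coeff_one_plus_X_power del: One_nat_def)
    qed (simp add: coeff_monom_mult)
  qed
  finally show ?thesis by (simp add: atLeast0AtMost)
qed

section \<open>The binomial transform\<close>

text \<open>The value at the letter \<open>p + 1\<close> of the function with coefficients \<open>x\<close> in the basis of the
  binomial coefficients. Only the values of \<open>x\<close> at nonnegative integers enter; the index is an integer so that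
  boundary conditions can be expressed as \<open>x (- 1) = 0\<close>.\<close>

definition binom_transform :: "(int \<Rightarrow> real) \<Rightarrow> nat \<Rightarrow> real" where
  "binom_transform x p = (\<Sum>j\<le>p. real (p choose j) * x (int j))"

lemma binom_transform_add:
  "binom_transform x p + binom_transform y p = binom_transform (\<lambda>j. x j + y j) p"
  by (simp add: binom_transform_def sum.distrib algebra_simps)

lemma binom_transform_cong:
  "(\<And>j. 0 \<le> j \<Longrightarrow> x j = y j) \<Longrightarrow> binom_transform x p = binom_transform y p"
  by (simp add: binom_transform_def)

lemma binom_transform_0 [simp]: "binom_transform x 0 = x 0"
  by (simp add: binom_transform_def)

text \<open>Pascal's rule: the difference operator shifts the coefficients.\<close>

lemma binom_transform_Suc:
  "binom_transform x (Suc p) = binom_transform x p + binom_transform (\<lambda>j. x (j + 1)) p"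
proof -
  have "(\<Sum>j\<le>p. real (p choose Suc j) * x (1 + int j)) + x 0 = (\<Sum>j\<le>Suc p. real (p choose j) * x (int j))"
    by (subst sum.atMost_Suc_shift) simp
  then show ?thesis
    unfolding binom_transform_def
    by (subst sum.atMost_Suc_shift) (simp add: sum.distrib algebra_simps)
qed

text \<open>Summation inverts the difference operator, hence shifts the coefficients the other way. The
  condition at \<open>- 1\<close> makes the constant of summation vanish.\<close>

lemma sum_binom_transform:
  assumes "x (- 1) = 0"
  shows "(\<Sum>q<p. binom_transform x q) = binom_transform (\<lambda>j. x (j - 1)) p"
  using assms by (induction p) (simp_all add: binom_transform_Suc)

text \<open>The two kinds of successors of a letter, all smaller letters and the next larger one,
  together become one step of a walk.\<close>

lemma transition_binom_transform:
  assumes "x (- 1) = 0"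
  shows "(\<Sum>q<p. binom_transform x q) + binom_transform x (Suc p) =
    binom_transform (\<lambda>j. x (j - 1) + x j + x (j + 1)) p"
  unfolding sum_binom_transform[of x, OF assms] binom_transform_Suc
  by (simp add: binom_transform_add add.assoc)

text \<open>On a single basis function this is
  \<open>(p + 1) * (p choose j) = (j + 1) * (p + 1 choose j + 1) = (j + 1) * ((p choose j) + (p choose j + 1))\<close>.\<close>

lemma mult_binom_transform:
  "real (Suc p) * binom_transform x p =
    binom_transform (\<lambda>j. (real_of_int j + 1) * x j + real_of_int j * x (j - 1)) p"
proof (induction p arbitrary: x)
  case (Suc p)
  let ?x' = "\<lambda>j. x (j + 1)"
  have "real (Suc (Suc p)) * binom_transform x (Suc p) = 
     binom_transform x p + real (Suc p) * binom_transform x p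
      + (binom_transform ?x' p + real (Suc p) * binom_transform ?x' p)"
    by (simp add: binom_transform_Suc algebra_simps)
  then show ?case
    unfolding Suc.IH
    by (simp add: binom_transform_Suc binom_transform_add)
       (simp add: algebra_simps)
qed simp

section \<open>Words with a given first letter\<close>

text \<open>Motzkin words with an arbitrary first letter, so that removing the first letter stays within
  the family.\<close>

definition words_from :: "nat \<Rightarrow> nat \<Rightarrow> nat list set" where
  "words_from n a = {w. length w = n \<and> (\<forall>x\<in>set w. 1 \<le> x) \<and> w ! 0 = a \<and>
     (\<forall>k\<in>{1..<n}. w ! k \<le> w ! (k - 1) + 1 \<and> w ! (k - 1) \<noteq> w ! k)}"

lemma motzkin_words_eq_words_from: "motzkin_words n = words_from n 1"
  by (simp add: motzkin_words_def words_from_def)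

lemma words_from_1: "words_from (Suc 0) (Suc p) = {[Suc p]}"
  by (auto simp: words_from_def length_Suc_conv)

lemma Cons_in_words_from:
  "a # w \<in> words_from (Suc (Suc m)) (Suc p) \<longleftrightarrow>
    a = Suc p \<and> (\<exists>q\<in>insert (Suc p) {..<p}. w \<in> words_from (Suc m) (Suc q))"
proof -
  have all_split: "(\<forall>k\<in>{1..<Suc (Suc m)}. P k) \<longleftrightarrow> P 1 \<and> (\<forall>k\<in>{1..<Suc m}. P (Suc k))" for P
  proof -
    have eq: "{1..<Suc (Suc m)} = insert 1 (Suc ` {1..<Suc m})"
      by (auto simp: image_iff)
    show ?thesis by (simp only: eq ball_simps)
  qed
  have nth_pred: "(a # w) ! k = w ! (k - 1)" if "k \<in> {1..<Suc m}" for k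
    using that by auto
  have hd_ge: "1 \<le> w ! 0" if "length w = Suc m" "\<forall>x\<in>set w. 1 \<le> x"
    using that by (metis nth_mem zero_less_Suc)
  have "a # w \<in> words_from (Suc (Suc m)) (Suc p) \<longleftrightarrow>
     length w = Suc m \<and> a = Suc p \<and> (\<forall>x\<in>set w. 1 \<le> x) \<and> 
     w ! 0 \<le> Suc (Suc p) \<and> w ! 0 \<noteq> Suc p \<and>
     (\<forall>k\<in>{1..<Suc m}. w ! k \<le> w ! (k - 1) + 1 \<and> w ! (k - 1) \<noteq> w ! k)"
    unfolding words_from_def mem_Collect_eq all_split using nth_pred by auto
  also have "\<dots> \<longleftrightarrow> a = Suc p \<and> (\<exists>q\<in>insert (Suc p) {..<p}. w \<in> words_from (Suc m) (Suc q))"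
  proof -
    have "w ! 0 \<le> Suc (Suc p) \<and> w ! 0 \<noteq> Suc p \<longleftrightarrow> (\<exists>q\<in>insert (Suc p) {..<p}. w ! 0 = Suc q)"
      if "1 \<le> w ! 0"
      using that by (cases "w ! 0") auto
    with hd_ge show ?thesis unfolding words_from_def by auto
  qed
  finally show ?thesis .
qed

lemma words_from_Suc:
  "words_from (Suc (Suc m)) (Suc p) =
    (\<Union>q\<in>insert (Suc p) {..<p}. (#) (Suc p) ` words_from (Suc m) (Suc q))"
proof (rule set_eqI)
  fix w
  show "w \<in> words_from (Suc (Suc m)) (Suc p) \<longleftrightarrow>
    w \<in> (\<Union>q\<in>insert (Suc p) {..<p}. (#) (Suc p) ` words_from (Suc m) (Suc q))"
  proof (cases w)
    case Nil
    then show ?thesis by (auto simp: words_from_def)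
  next
    case (Cons a v)
    then show ?thesis unfolding Cons Cons_in_words_from by auto
  qed
qed

lemma finite_words_from: "finite (words_from (Suc m) (Suc p))"
  by (induction m arbitrary: p) (simp_all add: words_from_1 words_from_Suc)

lemma sum_words_from_Suc:
  "(\<Sum>w\<in>words_from (Suc (Suc m)) (Suc p). f w) =
    (\<Sum>q<p. \<Sum>w\<in>words_from (Suc m) (Suc q). f (Suc p # w)) +
    (\<Sum>w\<in>words_from (Suc m) (Suc (Suc p)). (f (Suc p # w) :: real))"
proof -
  have "(\<Sum>w\<in>words_from (Suc (Suc m)) (Suc p). f w) =
      (\<Sum>q\<in>insert (Suc p) {..<p}. \<Sum>w\<in>(#) (Suc p) ` words_from (Suc m) (Suc q). f w)"
    unfolding words_from_Suc
  proof (rule sum.UNION_disjoint)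
    show "\<forall>i\<in>insert (Suc p) {..<p}. \<forall>j\<in>insert (Suc p) {..<p}. i \<noteq> j \<longrightarrow>
       (#) (Suc p) ` words_from (Suc m) (Suc i) \<inter> (#) (Suc p) ` words_from (Suc m) (Suc j) = {}"
      by (auto simp: words_from_def)
  qed (simp_all add: finite_words_from)
  also have "\<dots> = (\<Sum>q\<in>insert (Suc p) {..<p}. \<Sum>w\<in>words_from (Suc m) (Suc q). f (Suc p # w))"
    by (simp add: sum.reindex)
  finally show ?thesis by (simp add: add.commute)
qed

section \<open>Counting words and their area\<close>

text \<open>By the reflection principle, for \<open>j \<ge> 0\<close> this counts the walks from 0 to \<open>j\<close> that never
  reach \<open>- 1\<close>:
  a walk from 0 to \<open>j\<close> through \<open>- 1\<close> corresponds to a walk from \<open>- 2\<close> to \<open>j\<close>.\<close>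

definition count_coeff :: "nat \<Rightarrow> int \<Rightarrow> real" where
  "count_coeff n j = trin n j - trin n (j + 2)"

text \<open>This solves the recurrence \<open>area_coeff_Suc\<close> below. The shape comes from generating functions:
  if \<open>S = z * (1 + S + S\<^sup>2)\<close>, the walks to \<open>j\<close> have a generating function proportional to \<open>S ^ j\<close>, and
  the inhomogeneous term, which is linear in \<open>j\<close> times \<open>S ^ j\<close>, forces a solution that is quadratic in
  \<open>j\<close> times \<open>S ^ j\<close>. The factor \<open>j + 1\<close> is the boundary condition at \<open>- 1\<close>.\<close>

definition area_coeff :: "nat \<Rightarrow> int \<Rightarrow> real" where
  "area_coeff n j = (j + 1) * (j / 2 * (trin n j + trin n (j + 1)) + trin_above n j)"

lemma count_coeff_minus_1: "count_coeff n (- 1) = 0"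
  using trin_minus[of n 1] by (simp add: count_coeff_def)

lemma area_coeff_minus_1: "area_coeff n (- 1) = 0"
  by (simp add: area_coeff_def)

lemma area_coeff_0: "0 \<le> j \<Longrightarrow> area_coeff 0 j = 0"
  by (simp add: area_coeff_def)

lemma count_coeff_Suc:
  "count_coeff (Suc n) j = count_coeff n (j - 1) + count_coeff n j + count_coeff n (j + 1)"
  by (simp add: count_coeff_def algebra_simps)

text \<open>Putting a new first letter in front of the words of length \<open>n\<close> adds that letter once for each
  word obtained, which is the contribution of \<open>count_coeff\<close> as in \<open>mult_binom_transform\<close>, and keeps the old area,
  which is the walk step. Expressing all tails through \<open>trin_above n (j + 1)\<close> leaves an identity
  that is linear in the values of \<open>trin n\<close>.\<close>

lemma area_coeff_Suc:
  "area_coeff (Suc n) j = (j + 1) * count_coeff n j + j * count_coeff n (j - 1)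
     + (area_coeff n (j - 1) + area_coeff n j + area_coeff n (j + 1))"
proof -
  have t: "trin_above n (j - 1) = trin_above n (j + 1) + trin n (j + 1) + trin n j"
    "trin_above n j = trin_above n (j + 1) + trin n (j + 1)"
    using trin_above_pred[of n j] trin_above_pred[of n "j + 1"] by simp_all
  show ?thesis
    unfolding area_coeff_def count_coeff_def trin.simps trin_above.simps t
    by (simp add: field_simps)
qed

lemma card_words_from:
  "real (card (words_from (Suc m) (Suc p))) = binom_transform (count_coeff m) p"
proof (induction m arbitrary: p)
  case 0
  have "binom_transform (count_coeff 0) p = (\<Sum>j\<le>p. if j = 0 then real (p choose 0) else 0)"
    unfolding binom_transform_def by (intro sum.cong) (auto simp: count_coeff_def)
  then show ?case by (simp add: words_from_1)
next
  case (Suc m)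
  have "real (card (words_from (Suc (Suc m)) (Suc p))) =
      (\<Sum>q<p. real (card (words_from (Suc m) (Suc q)))) + real (card (words_from (Suc m) (Suc (Suc p))))"
    using sum_words_from_Suc[of "\<lambda>_. 1" m p] by simp
  then show ?case
    unfolding Suc.IH transition_binom_transform[of "count_coeff m", OF count_coeff_minus_1]
    by (simp add: count_coeff_Suc)
qed

lemma sum_area_words_from:
  "(\<Sum>w\<in>words_from (Suc m) (Suc p). real (sum_list w)) = binom_transform (area_coeff (Suc m)) p"
proof (induction m arbitrary: p)
  case 0
  \<comment> \<open>One-letter words fit the general recurrence, with empty words as predecessors of area 0.\<close>
  have "real (Suc p) = real (Suc p) * binom_transform (count_coeff 0) p"
    using card_words_from[of 0 p] by (simp add: words_from_1)
  also have "\<dots> = binom_transform (area_coeff (Suc 0)) p"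
    unfolding mult_binom_transform
  proof (rule binom_transform_cong)
    fix j :: int assume "0 \<le> j"
    then have "area_coeff 0 (j - 1) = 0" "area_coeff 0 j = 0" "area_coeff 0 (j + 1) = 0"
      using area_coeff_minus_1[of 0] area_coeff_0 by (cases "j = 0"; simp)+
    then show "(real_of_int j + 1) * count_coeff 0 j + real_of_int j * count_coeff 0 (j - 1) =
        area_coeff (Suc 0) j"
      by (simp only: area_coeff_Suc add_0_right)
  qed
  finally show ?case by (simp add: words_from_1)
next
  case (Suc m)
  let ?A = "\<lambda>m p. \<Sum>w\<in>words_from (Suc m) (Suc p). real (sum_list w)"
  let ?C = "\<lambda>m p. real (card (words_from (Suc m) (Suc p)))"
  have C: "(\<Sum>q<p. ?C m q) + ?C m (Suc p) = ?C (Suc m) p"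
    using sum_words_from_Suc[of "\<lambda>_. 1" m p] by simp
  have "?A (Suc m) p = (\<Sum>q<p. real (Suc p) * ?C m q + ?A m q) + (real (Suc p) * ?C m (Suc p) + ?A m (Suc p))"
    unfolding sum_words_from_Suc sum_list.Cons of_nat_add sum.distrib
    by (simp add: mult.commute del: of_nat_Suc)
  also have "\<dots> = real (Suc p) * ((\<Sum>q<p. ?C m q) + ?C m (Suc p)) + ((\<Sum>q<p. ?A m q) + ?A m (Suc p))"
    unfolding sum.distrib sum_distrib_left[symmetric] by (simp only: distrib_left ac_simps)
  also have "\<dots> = real (Suc p) * binom_transform (count_coeff (Suc m)) p +
     binom_transform (\<lambda>j. area_coeff (Suc m) (j - 1) + area_coeff (Suc m) j + area_coeff (Suc m) (j + 1)) p"
    unfolding C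
    unfolding card_words_from Suc.IH
      transition_binom_transform[of "area_coeff (Suc m)", OF area_coeff_minus_1] ..
  also have "\<dots> = binom_transform (area_coeff (Suc (Suc m))) p"
    unfolding mult_binom_transform binom_transform_add area_coeff_Suc[of "Suc m", symmetric] ..
  finally show ?case .
qed

text \<open>For the first letter 1 the binomial transform is evaluated at 0, where only the coefficient of
  index 0 survives.\<close>

lemma total_area_eq_trin_above:
  assumes "n \<ge> 1"
  shows "real (total_area n) = trin_above n 0"
proof -
  obtain m where n: "n = Suc m" using assms by (cases n) auto
  have "real (total_area n) = (\<Sum>w\<in>words_from (Suc m) (Suc 0). real (sum_list w))"
    by (simp add: total_area_def area_eq_sum_list motzkin_words_eq_words_from n)
  also have "\<dots> = trin_above n 0"
    unfolding sum_area_words_from n by (simp add: area_coeff_def)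
  finally show ?thesis .
qed

section \<open>The central trinomial coefficients are negligible\<close>

text \<open>By induction, the value at \<open>j + 1\<close> sums a window of the previous row that differs from the
  window at \<open>j\<close> only in its end points. For \<open>j = 0\<close> the lost end point \<open>- 1\<close> is handled by symmetry.\<close>

lemma trin_antimono: "0 \<le> j \<Longrightarrow> trin n (j + 1) \<le> trin n j"
proof (induction n arbitrary: j)
  case (Suc n)
  have "trin n (j + 1) \<le> trin n (j - 1)"
  proof (cases "j = 0")
    case True
    then show ?thesis using trin_minus[of n 1] by simp
  next
    case False
    then show ?thesis using Suc.IH[of "j - 1"] Suc.IH[of j] Suc.prems by simp
  qed
  moreover have "trin n (j + 2) \<le> trin n (j + 1)"
    using Suc.IH[of "j + 1"] Suc.prems by (simp add: add.assoc)
  ultimately show ?case by (simp add: add.assoc)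
qed simp

lemma trin_Suc_0: "trin (Suc n) 0 = trin n 0 + 2 * trin n 1"
  using trin_minus[of n 1] by simp

text \<open>The recurrence expresses the value at \<open>j + 1\<close> through the next row at \<open>j\<close>, whose proportions
  have to be scaled by 3, and the same row at \<open>j\<close> and \<open>j - 1\<close>; so limits propagate outwards as
  \<open>3 * L - L - L = L\<close>. For \<open>j = 1\<close> symmetry replaces the value at \<open>- 1\<close>.\<close>

lemma trin_div_tendsto_same:
  assumes "(\<lambda>n. trin n 0 / 3 ^ n) \<longlonglongrightarrow> L"
  shows "(\<lambda>n. trin n (int j) / 3 ^ n) \<longlonglongrightarrow> L"
proof (induction j rule: less_induct)
  case (less j)
  consider "j = 0" | "j = 1" | i where "j = Suc (Suc i)"
    by (metis One_nat_def not0_implies_Suc)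
  then show ?case
  proof cases
    case 2
    have "(\<lambda>n. (3 * (trin (Suc n) 0 / 3 ^ Suc n) - trin n 0 / 3 ^ n) / 2) \<longlonglongrightarrow> (3 * L - L) / 2"
      by (intro tendsto_divide tendsto_diff tendsto_mult tendsto_const assms LIMSEQ_Suc[OF assms]) simp
    moreover have "(3 * (trin (Suc n) 0 / 3 ^ Suc n) - trin n 0 / 3 ^ n) / 2 = trin n (int j) / 3 ^ n" for n
      unfolding trin_Suc_0 2 by (simp add: field_simps)
    ultimately show ?thesis by simp
  next
    case (3 i)
    have IH: "(\<lambda>n. trin n (int i) / 3 ^ n) \<longlonglongrightarrow> L"
      "(\<lambda>n. trin n (int (Suc i)) / 3 ^ n) \<longlonglongrightarrow> L"
      using less.IH[of i] less.IH[of "Suc i"] 3 by simp_all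
    have "(\<lambda>n. 3 * (trin (Suc n) (int (Suc i)) / 3 ^ Suc n) - trin n (int (Suc i)) / 3 ^ n
        - trin n (int i) / 3 ^ n) \<longlonglongrightarrow> 3 * L - L - L"
      by (intro tendsto_diff tendsto_mult tendsto_const IH LIMSEQ_Suc[OF IH(2)])
    moreover have "3 * (trin (Suc n) (int (Suc i)) / 3 ^ Suc n) - trin n (int (Suc i)) / 3 ^ n
        - trin n (int i) / 3 ^ n = trin n (int j) / 3 ^ n" for n
      unfolding 3 by (simp add: field_simps)
    ultimately show ?thesis by simp
  qed (simp add: assms)
qed

lemma sum_trin: "(\<Sum>j<J. trin n (int j)) = trin_above n (- 1) - trin_above n (int J - 1)"
proof (induction J)
  case (Suc J)
  then show ?case using trin_above_pred[of n "int J"] by simp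
qed simp

text \<open>If the limit \<open>L\<close> were positive, then more than \<open>1 / L\<close> end points, each reached by a proportion
  tending to \<open>L\<close>, would together receive more than all walks.\<close>

lemma trin_0_div_tendsto_0: "(\<lambda>n. trin n 0 / 3 ^ n) \<longlonglongrightarrow> 0"
proof -
  have "decseq (\<lambda>n. trin n 0 / 3 ^ n)"
  proof (rule decseq_SucI)
    fix n
    show "trin (Suc n) 0 / 3 ^ Suc n \<le> trin n 0 / 3 ^ n"
      unfolding trin_Suc_0 using trin_antimono[of 0 n] by (simp add: field_simps)
  qed
  moreover have nonneg: "0 \<le> trin n 0 / 3 ^ n" for n
    by (simp add: trin_nonneg)
  ultimately obtain L where L: "(\<lambda>n. trin n 0 / 3 ^ n) \<longlonglongrightarrow> L"
    using decseq_convergent[of _ 0] by blast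
  have bound: "real J * L \<le> 1" for J
  proof -
    have "(\<lambda>n. \<Sum>j<J. trin n (int j) / 3 ^ n) \<longlonglongrightarrow> (\<Sum>j<J. L)"
      by (intro tendsto_sum trin_div_tendsto_same L)
    moreover have "(\<Sum>j<J. trin n (int j) / 3 ^ n) \<le> 1" for n
    proof -
      have "(\<Sum>j<J. trin n (int j)) \<le> 3 ^ n"
        unfolding sum_trin
        using trin_above_reflect[of n 0] trin_above_nonneg[of n 0] trin_above_nonneg[of n "int J - 1"]
        by simp
      then show ?thesis by (simp add: sum_divide_distrib[symmetric])
    qed
    ultimately show ?thesis by (auto dest: LIMSEQ_le_const2)
  qed
  have "L \<le> 0"
  proof (rule ccontr)
    assume "\<not> L \<le> 0"
    then obtain J where "1 < real J * L" using reals_Archimedean3[of L] by auto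
    with bound[of J] show False by simp
  qed
  moreover have "0 \<le> L" using L nonneg by (auto intro: LIMSEQ_le_const)
  ultimately show ?thesis using L by simp
qed

theorem theorem5p3:
  shows "(\<forall>n::nat. n \<ge> 1 \<longrightarrow>
            real (total_area n) = 1 / 2 * (3 ^ n - real (central_trinomial n)) \<and>
            1 / 2 * (3 ^ n - real (central_trinomial n)) =
              1 / 2 * (3 ^ n - real (\<Sum>k=0..n. (n choose k) * ((n - k) choose k)))) \<and>
         asymp_equiv (\<lambda>n. real (total_area n)) at_top (\<lambda>n. 3 ^ n / 2)"
proof
  have area: "real (total_area n) = 1 / 2 * (3 ^ n - real (central_trinomial n))" if "n \<ge> 1" for n
    using that by (simp add: total_area_eq_trin_above trin_above_0 central_trinomial_eq_trin)
  then show "\<forall>n::nat. n \<ge> 1 \<longrightarrow>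
      real (total_area n) = 1 / 2 * (3 ^ n - real (central_trinomial n)) \<and>
      1 / 2 * (3 ^ n - real (central_trinomial n)) =
        1 / 2 * (3 ^ n - real (\<Sum>k=0..n. (n choose k) * ((n - k) choose k)))"
    by (simp add: central_trinomial_eq_sum)
  have "(\<lambda>n. 1 - trin n 0 / 3 ^ n) \<longlonglongrightarrow> 1 - 0"
    by (intro tendsto_intros trin_0_div_tendsto_0)
  moreover have "\<forall>\<^sub>F n in sequentially. 1 - trin n 0 / 3 ^ n = real (total_area n) / (3 ^ n / 2)"
    using eventually_ge_at_top[of 1]
    by eventually_elim (simp add: area central_trinomial_eq_trin field_simps)
  ultimately have "(\<lambda>n. real (total_area n) / (3 ^ n / 2)) \<longlonglongrightarrow> 1"
    by (simp add: tendsto_cong)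
  then show "asymp_equiv (\<lambda>n. real (total_area n)) at_top (\<lambda>n. 3 ^ n / 2)"
    by (rule asymp_equivI')
qed

end
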